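(* Consider the system of differential equations for $(\boldsymbol v,\boldsymbol\omega,\boldsymbol\gamma)\in\mathbb R^3\times\mathbb R^3\times\mathbb R^3$ (rolling with slipping of an axisymmetric unbalanced ball on a horizontal plane) $$m\dot{\boldsymbol v}+\boldsymbol\omega\times m\boldsymbol v+m\,\frac{d}{dt}\big[(\boldsymbol\omega,\boldsymbol r\times\boldsymbol\gamma)\big]\,\boldsymbol\gamma=\boldsymbol F_{\|},$$ $$\mathbf J\dot{\boldsymbol\omega}+\boldsymbol\omega\times\mathbf I\boldsymbol\omega+m\Big(\big(\boldsymbol\omega,\tfrac{d}{dt}(\boldsymbol r\times\boldsymbol\gamma)\big)-\mathrm g\Big)\,\boldsymbol r\times\boldsymbol\gamma=\boldsymbol M_f-\boldsymbol r\times\boldsymbol F_{\bot},\qquad \dot{\boldsymbol\gamma}+\boldsymbol\omega\times\boldsymbol\gamma=0,$$ restricted to the set $(\boldsymbol v+\boldsymbol\omega\times\boldsymbol r,\boldsymbol\gamma)=0$, $(\boldsymbol\gamma,\boldsymbol\gamma)=1$. For an arbitrary resistance force $\boldsymbol F=\boldsymbol F(\boldsymbol v,\boldsymbol\omega,\boldsymbol\gamma)$, this system admits an additional first integral, linear in $\boldsymbol\omega$, under the following restrictions on the rolling resistance torque $\boldsymbol M_f=\boldsymbol M_f(\boldsymbol v,\boldsymbol\omega,\boldsymbol\gamma)$: 1. if $(\boldsymbol M_f,\boldsymbol r)=0$, then the Jellett integral $G=-(\mathbf J\boldsymbol\omega,\boldsymbol r)$ is constant along solutions; 2. if $(\boldsymbol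 M_f,\boldsymbol e_3)=0$, then the Lagrange integral $F=i_3\omega_3$ is constant along solutions; 3. if $(\boldsymbol M_f,\boldsymbol\gamma)=0$, then the area integral $C=(\mathbf J\boldsymbol\omega,\boldsymbol\gamma)$ is constant along solutions.
   Context: All vectors are written in a frame attached to the ball, with origin at its center of mass and third axis along the symmetry axis; $(\cdot,\cdot)$ and $\times$ are the Euclidean inner and cross products of $\mathbb R^3$, and $\boldsymbol e_3=(0,0,1)$. Here $m>0$ is the mass, $R>0$ the radius, $\mathrm g>0$ the free-fall acceleration, $\boldsymbol v$ the velocity of the center of mass, $\boldsymbol\omega=(\omega_1,\omega_2,\omega_3)$ the angular velocity, $\boldsymbol\gamma=(\gamma_1,\gamma_2,\gamma_3)$ the upward vertical unit vector, $\mathbf I=\mathrm{diag}(i_1,i_1,i_3)$ with $i_1,i_3>0$ the central tensor of inertia, $\boldsymbol a=(0,0,a)$ the displacement of the center of mass from the geometric center, $\boldsymbol r=-R\boldsymbol\gamma-\boldsymbol a$ the radius vector of the contact point, and $\mathbf J=\mathbf I+m(\boldsymbol r\times\boldsymbol\gamma)\otimes(\boldsymbol r\times\boldsymbol\gamma)$, where $(\boldsymbol x\otimes\boldsymbol y)_{ij}=x_iy_j$. Furthermore, $\boldsymbol F_{\bot}=(\boldsymbol F,\boldsymbol\gamma)\boldsymbol\gamma$ and $\boldsymbol F_{\|}=\boldsymbol F-\boldsymbol F_{\bot}$. The force $\boldsymbol F$ is applied at the contact point; $\boldsymbol M_f$ is the total rolling resistance torque, which includes $\boldsymbol r\times\boldsymbol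 F$ but need not equal it. Each condition on $\boldsymbol M_f$ is understood to hold identically in the phase variables. (The scalar integral $F$ in item 2 is not to be confused with the force $\boldsymbol F$.) *)

theory Defs
  imports "HOL-Analysis.Analysis"
begin

unbundle cross3_syntax

definition e3 :: "real^3" where
  "e3 = axis 3 1"

definition outer :: "real^3 \<Rightarrow> real^3 \<Rightarrow> real^3^3" where
  "outer x y = (\<chi> i j. x $ i * y $ j)"

text \<open>Radius vector of the contact point, with the displacement vector \<open>(0,0,a)\<close>.\<close>

definition contact_vec :: "real \<Rightarrow> real \<Rightarrow> real^3 \<Rightarrow> real^3" where
  "contact_vec R a \<gamma> = - (R *\<^sub>R \<gamma>) - a *\<^sub>R e3"

definition inertia :: "real \<Rightarrow> real \<Rightarrow> real^3^3" where
  "inertia i1 i3 = (\<chi> i j. if i = j then vector [i1, i1, i3] $ i else 0)"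

definition inertia_J :: "real \<Rightarrow> real \<Rightarrow> real \<Rightarrow> real \<Rightarrow> real \<Rightarrow> real^3 \<Rightarrow> real^3^3" where
  "inertia_J m R i1 i3 a \<gamma> =
     inertia i1 i3 + m *\<^sub>R outer (contact_vec R a \<gamma> \<times> \<gamma>) (contact_vec R a \<gamma> \<times> \<gamma>)"

definition normal_part :: "real^3 \<Rightarrow> real^3 \<Rightarrow> real^3" where
  "normal_part \<gamma> f = (f \<bullet> \<gamma>) *\<^sub>R \<gamma>"

definition tangential_part :: "real^3 \<Rightarrow> real^3 \<Rightarrow> real^3" where
  "tangential_part \<gamma> f = f - normal_part \<gamma> f"

definition phase_set :: "real \<Rightarrow> real \<Rightarrow> ((real^3) \<times> (real^3) \<times> (real^3)) set" where
  "phase_set R a = {(v, \<omega>, \<gamma>). (v + \<omega> \<times> contact_vec R a \<gamma>) \<bullet> \<gamma> = 0 \<and> \<gamma> \<bullet> \<gamma> = 1}"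

text \<open>Solutions live on an arbitrary nondegenerate interval \<open>T\<close>; derivatives are taken within
  \<open>T\<close>, hence are one-sided at those endpoints that belong to \<open>T\<close>. The resistance force and torque
  are arbitrary functions of the state, without regularity assumptions.\<close>

definition solution ::
  "real \<Rightarrow> real \<Rightarrow> real \<Rightarrow> real \<Rightarrow> real \<Rightarrow> real
    \<Rightarrow> (real^3 \<Rightarrow> real^3 \<Rightarrow> real^3 \<Rightarrow> real^3) \<Rightarrow> (real^3 \<Rightarrow> real^3 \<Rightarrow> real^3 \<Rightarrow> real^3)
    \<Rightarrow> real set \<Rightarrow> (real \<Rightarrow> real^3) \<Rightarrow> (real \<Rightarrow> real^3) \<Rightarrow> (real \<Rightarrow> real^3) \<Rightarrow> bool" where
  "solution m R g i1 i3 a Force Mf T v \<omega> \<gamma> \<longleftrightarrow>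
     is_interval T \<and> interior T \<noteq> {} \<and>
     v differentiable_on T \<and> \<omega> differentiable_on T \<and> \<gamma> differentiable_on T \<and>
     (\<forall>t\<in>T.
        let r = (\<lambda>s. contact_vec R a (\<gamma> s));
            D = (\<lambda>f. vector_derivative f (at t within T));
            f = Force (v t) (\<omega> t) (\<gamma> t)
        in
          (v t, \<omega> t, \<gamma> t) \<in> phase_set R a \<and>
          m *\<^sub>R D v + \<omega> t \<times> (m *\<^sub>R v t)
            + (m * vector_derivative (\<lambda>s. \<omega> s \<bullet> (r s \<times> \<gamma> s)) (at t within T)) *\<^sub>R \<gamma> t
            = tangential_part (\<gamma> t) f \<and>
          inertia_J m R i1 i3 a (\<gamma> t) *v D \<omega> + \<omega> t \<times> (inertia i1 i3 *v \<omega> t)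
            + (m * (\<omega> t \<bullet> D (\<lambda>s. r s \<times> \<gamma> s) - g)) *\<^sub>R (r t \<times> \<gamma> t)
            = Mf (v t) (\<omega> t) (\<gamma> t) - r t \<times> normal_part (\<gamma> t) f \<and>
          D \<gamma> + \<omega> t \<times> \<gamma> t = 0)"

text \<open>A first integral is additional if it is not merely a function of the constraints, i.e. if it
  is not constant on the phase set.\<close>

definition additional_linear_integral ::
  "real \<Rightarrow> real \<Rightarrow> real \<Rightarrow> real \<Rightarrow> real \<Rightarrow> real
    \<Rightarrow> (real^3 \<Rightarrow> real^3 \<Rightarrow> real^3 \<Rightarrow> real^3) \<Rightarrow> (real^3 \<Rightarrow> real^3 \<Rightarrow> real^3 \<Rightarrow> real^3)
    \<Rightarrow> (real^3 \<Rightarrow> real^3 \<Rightarrow> real^3 \<Rightarrow> real) \<Rightarrow> bool" where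
  "additional_linear_integral m R g i1 i3 a Force Mf \<Phi> \<longleftrightarrow>
     (\<forall>v \<gamma>. linear (\<lambda>\<omega>. \<Phi> v \<omega> \<gamma>)) \<and>
     \<not> (\<exists>c. \<forall>(v, \<omega>, \<gamma>) \<in> phase_set R a. \<Phi> v \<omega> \<gamma> = c) \<and>
     (\<forall>T v \<omega> \<gamma>. solution m R g i1 i3 a Force Mf T v \<omega> \<gamma> \<longrightarrow>
        (\<exists>c. \<forall>t\<in>T. \<Phi> (v t) (\<omega> t) (\<gamma> t) = c))"

definition jellett_integral ::
  "real \<Rightarrow> real \<Rightarrow> real \<Rightarrow> real \<Rightarrow> real \<Rightarrow> real^3 \<Rightarrow> real^3 \<Rightarrow> real^3 \<Rightarrow> real" where
  "jellett_integral m R i1 i3 a v \<omega> \<gamma> = - ((inertia_J m R i1 i3 a \<gamma> *v \<omega>) \<bullet> contact_vec R a \<gamma>)"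

definition lagrange_integral :: "real \<Rightarrow> real^3 \<Rightarrow> real^3 \<Rightarrow> real^3 \<Rightarrow> real" where
  "lagrange_integral i3 v \<omega> \<gamma> = i3 * \<omega> $ 3"

definition area_integral ::
  "real \<Rightarrow> real \<Rightarrow> real \<Rightarrow> real \<Rightarrow> real \<Rightarrow> real^3 \<Rightarrow> real^3 \<Rightarrow> real^3 \<Rightarrow> real" where
  "area_integral m R i1 i3 a v \<omega> \<gamma> = (inertia_J m R i1 i3 a \<gamma> *v \<omega>) \<bullet> \<gamma>"

end

theory Submission
  imports Defs
begin

text \<open>All three integrals have the form \<open>(I \<omega>, K)\<close> with \<open>K = \<alpha> \<gamma> + \<beta> e3\<close> a combination of the vertical
  and the symmetry axis with constant coefficients: \<open>K = - r = R \<gamma> + a e3\<close> gives the Jellett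
  integral, \<open>K = e3\<close> the Lagrange integral and \<open>K = \<gamma>\<close> the area integral.

  The vector \<open>r \<times> \<gamma> = - a e3 \<times> \<gamma>\<close> is orthogonal to every such \<open>K\<close>. Pairing the angular momentum
  equation with \<open>K\<close> therefore removes the rank-one part of \<open>J\<close>, the gravity and constraint term, and
  the torque of the normal force, and leaves \<open>(I \<omega>', K) + (\<omega> \<times> I \<omega>, K) = (M, K)\<close>. The gyroscopic
  term is compensated exactly by the rotation of \<open>K\<close> relative to the ball: for the \<open>\<gamma>\<close> part this
  is \<open>\<gamma>' = - \<omega> \<times> \<gamma>\<close>, and for the \<open>e3\<close> part it is the axial symmetry of \<open>I\<close>, which makes
  \<open>(\<omega> \<times> I \<omega>, e3)\<close> vanish. So the derivative of \<open>(I \<omega>, K)\<close> is \<open>(M, K)\<close>, whatever the force is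
  (\<open>axial_momentum_derivative\<close>). A vanishing pairing \<open>(M, K)\<close> makes it constant, and
  positivity of \<open>I\<close> makes it a nonconstant function on the phase set
  (\<open>axial_momentum_is_integral\<close>).\<close>

definition axial_vec :: "real \<Rightarrow> real \<Rightarrow> real^3 \<Rightarrow> real^3" where
  "axial_vec \<alpha> \<beta> \<gamma> = \<alpha> *\<^sub>R \<gamma> + \<beta> *\<^sub>R e3"

lemma e3_nth: "e3 $ 1 = 0" "e3 $ 2 = 0" "e3 $ 3 = 1"
  by (simp_all add: e3_def axis_def)

lemma inertia_mult_nth:
  "(inertia i1 i3 *v w) $ 1 = i1 * w $ 1"
  "(inertia i1 i3 *v w) $ 2 = i1 * w $ 2"
  "(inertia i1 i3 *v w) $ 3 = i3 * w $ 3"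
  by (simp_all add: inertia_def matrix_vector_mult_def sum_3)

lemma outer_mult: "outer x y *v w = (y \<bullet> w) *\<^sub>R x"
  by (simp add: vec_eq_iff outer_def matrix_vector_mult_def inner_vec_def sum_distrib_left mult_ac)

lemma inner_3: "(x::real^3) \<bullet> y = x $ 1 * y $ 1 + x $ 2 * y $ 2 + x $ 3 * y $ 3"
  by (simp add: inner_vec_def sum_3)

lemma contact_cross_orthogonal: "(contact_vec R a \<gamma> \<times> \<gamma>) \<bullet> axial_vec \<alpha> \<beta> \<gamma> = 0"
  by (simp add: contact_vec_def axial_vec_def inner_3 cross3_def e3_nth algebra_simps)

lemma inertia_J_mult_inner_axial:
  "(inertia_J m R i1 i3 a \<gamma> *v w) \<bullet> axial_vec \<alpha> \<beta> \<gamma> = (inertia i1 i3 *v w) \<bullet> axial_vec \<alpha> \<beta> \<gamma>"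
  by (simp add: inertia_J_def matrix_vector_mult_add_rdistrib scaleR_matrix_vector_assoc [symmetric]
      outer_mult inner_add_left contact_cross_orthogonal)

lemma normal_torque_inner_axial:
  "(contact_vec R a \<gamma> \<times> normal_part \<gamma> f) \<bullet> axial_vec \<alpha> \<beta> \<gamma> = 0"
  by (simp add: normal_part_def cross_mult_right contact_cross_orthogonal)

text \<open>The term \<open>- \<alpha> \<omega> \<times> \<gamma>\<close> is the derivative of the axial vector along a solution. The \<open>\<gamma>\<close> parts
  cancel by the cyclic symmetry of the triple product, the \<open>e3\<close> part because the first two principal
  moments of inertia agree.\<close>

lemma gyroscopic_cancellation:
  "(\<omega> \<times> (inertia i1 i3 *v \<omega>)) \<bullet> axial_vec \<alpha> \<beta> \<gamma>
     = (inertia i1 i3 *v \<omega>) \<bullet> (- (\<alpha> *\<^sub>R (\<omega> \<times> \<gamma>)))"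
  by (simp add: axial_vec_def inner_3 cross3_def e3_nth inertia_mult_nth algebra_simps)

lemma axial_momentum_derivative:
  assumes sol: "solution m R g i1 i3 a Force Mf T v \<omega> \<gamma>" and t: "t \<in> T"
  shows "((\<lambda>s. (inertia i1 i3 *v \<omega> s) \<bullet> axial_vec \<alpha> \<beta> (\<gamma> s)) has_vector_derivative
            Mf (v t) (\<omega> t) (\<gamma> t) \<bullet> axial_vec \<alpha> \<beta> (\<gamma> t)) (at t within T)"
proof -
  let ?I = "inertia i1 i3" and ?K = "axial_vec \<alpha> \<beta> (\<gamma> t)" and ?r = "contact_vec R a (\<gamma> t)"
  define w' where "w' = vector_derivative \<omega> (at t within T)"
  define k where "k = m * (\<omega> t \<bullet> vector_derivative (\<lambda>s. contact_vec R a (\<gamma> s) \<times> \<gamma> s) (at t within T) - g)"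
  have \<omega>_der: "(\<omega> has_vector_derivative w') (at t within T)"
    using sol t unfolding solution_def w'_def differentiable_on_def
    by (blast intro: vector_derivative_works [THEN iffD1])
  have "vector_derivative \<gamma> (at t within T) = - (\<omega> t \<times> \<gamma> t)"
    using sol t unfolding solution_def Let_def by (simp add: eq_neg_iff_add_eq_0)
  moreover have "\<gamma> differentiable (at t within T)"
    using sol t unfolding solution_def differentiable_on_def by blast
  ultimately have \<gamma>_der: "(\<gamma> has_vector_derivative - (\<omega> t \<times> \<gamma> t)) (at t within T)"
    by (simp add: vector_derivative_works)
  have "inertia_J m R i1 i3 a (\<gamma> t) *v w' + \<omega> t \<times> (?I *v \<omega> t) + k *\<^sub>R (?r \<times> \<gamma> t)
      = Mf (v t) (\<omega> t) (\<gamma> t) - ?r \<times> normal_part (\<gamma> t) (Force (v t) (\<omega> t) (\<gamma> t))"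
    using sol t unfolding solution_def Let_def w'_def k_def by blast
  then have "(inertia_J m R i1 i3 a (\<gamma> t) *v w' + \<omega> t \<times> (?I *v \<omega> t) + k *\<^sub>R (?r \<times> \<gamma> t)) \<bullet> ?K
      = (Mf (v t) (\<omega> t) (\<gamma> t) - ?r \<times> normal_part (\<gamma> t) (Force (v t) (\<omega> t) (\<gamma> t))) \<bullet> ?K"
    by (rule arg_cong)
  then have balance: "(?I *v w') \<bullet> ?K + (?I *v \<omega> t) \<bullet> (- (\<alpha> *\<^sub>R (\<omega> t \<times> \<gamma> t)))
      = Mf (v t) (\<omega> t) (\<gamma> t) \<bullet> ?K"
    unfolding inner_add_left inner_diff_left inner_scaleR_left inertia_J_mult_inner_axial
      contact_cross_orthogonal normal_torque_inner_axial gyroscopic_cancellation by simp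
  have "((\<lambda>s. ?I *v \<omega> s) has_vector_derivative ?I *v w') (at t within T)"
    using bounded_linear.has_vector_derivative [OF matrix_vector_mul_bounded_linear \<omega>_der] .
  moreover have "((\<lambda>s. axial_vec \<alpha> \<beta> (\<gamma> s)) has_vector_derivative - (\<alpha> *\<^sub>R (\<omega> t \<times> \<gamma> t))) (at t within T)"
    unfolding axial_vec_def
    by (rule has_vector_derivative_eq_rhs, (rule derivative_intros \<gamma>_der)+) simp
  ultimately show ?thesis
    unfolding balance [symmetric] add.commute [of "(?I *v w') \<bullet> ?K"]
    by (rule bounded_bilinear.has_vector_derivative [OF bounded_bilinear_inner])
qed

lemma inertia_quadratic_pos:
  assumes "i1 > 0" and "i3 > 0" and "w \<noteq> 0"
  shows "(inertia i1 i3 *v w) \<bullet> w > 0"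
proof -
  have "(inertia i1 i3 *v w) \<bullet> w = i1 * ((w $ 1)\<^sup>2 + (w $ 2)\<^sup>2) + i3 * (w $ 3)\<^sup>2"
    by (simp add: inner_3 inertia_mult_nth power2_eq_square algebra_simps)
  moreover have "(w $ 1)\<^sup>2 + (w $ 2)\<^sup>2 > 0 \<or> (w $ 3)\<^sup>2 > 0"
    using assms(3) by (auto simp: vec_eq_iff forall_3 sum_power2_gt_zero_iff)
  ultimately show ?thesis
    using assms(1,2) by (auto intro: add_pos_nonneg add_nonneg_pos)
qed

text \<open>Every pair \<open>(\<omega>, \<gamma>)\<close> with \<open>\<gamma>\<close> a unit vector extends to a point of the phase set, by taking the
  velocity for which the contact point does not slip. So \<open>\<gamma>\<close> may be taken off the symmetry axis,
  where the axial vector does not vanish, and comparing \<open>\<omega> = 0\<close> with \<open>\<omega>\<close> equal to the axial vector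
  shows that the function is not constant.\<close>

lemma axial_momentum_not_constant:
  assumes "i1 > 0" and "i3 > 0" and "(\<alpha>, \<beta>) \<noteq> (0, 0)"
  shows "\<not> (\<exists>c. \<forall>(v, \<omega>, \<gamma>) \<in> phase_set R a. (inertia i1 i3 *v \<omega>) \<bullet> axial_vec \<alpha> \<beta> \<gamma> = c)"
proof
  assume "\<exists>c. \<forall>(v, \<omega>, \<gamma>) \<in> phase_set R a. (inertia i1 i3 *v \<omega>) \<bullet> axial_vec \<alpha> \<beta> \<gamma> = c"
  then obtain c where
    c: "\<And>v \<omega> \<gamma>. (v, \<omega>, \<gamma>) \<in> phase_set R a \<Longrightarrow> (inertia i1 i3 *v \<omega>) \<bullet> axial_vec \<alpha> \<beta> \<gamma> = c"
    by fast
  define \<gamma> :: "real^3" where "\<gamma> = axis 1 1"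
  define K where "K = axial_vec \<alpha> \<beta> \<gamma>"
  have phase: "(- (w \<times> contact_vec R a \<gamma>), w, \<gamma>) \<in> phase_set R a" for w
    by (simp add: phase_set_def \<gamma>_def inner_axis_axis)
  have "K $ 1 = \<alpha>" and "K $ 3 = \<beta>"
    by (simp_all add: K_def axial_vec_def \<gamma>_def e3_nth axis_def)
  then have "K \<noteq> 0"
    using assms(3) by auto
  moreover have "(inertia i1 i3 *v K) \<bullet> K = (inertia i1 i3 *v 0) \<bullet> K"
    using c [OF phase] unfolding K_def by metis
  ultimately show False
    using inertia_quadratic_pos [OF assms(1,2)] by force
qed

lemma axial_momentum_is_integral:
  assumes "i1 > 0" and "i3 > 0" and "(\<alpha>, \<beta>) \<noteq> (0, 0)"
    and Mf: "\<And>v \<omega> \<gamma>. (v, \<omega>, \<gamma>) \<in> phase_set R a \<Longrightarrow> Mf v \<omega> \<gamma> \<bullet> axial_vec \<alpha> \<beta> \<gamma> = 0"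
    and \<Phi>: "\<And>v \<omega> \<gamma>. \<Phi> v \<omega> \<gamma> = (inertia i1 i3 *v \<omega>) \<bullet> axial_vec \<alpha> \<beta> \<gamma>"
  shows "additional_linear_integral m R g i1 i3 a Force Mf \<Phi>"
  unfolding additional_linear_integral_def \<Phi>
proof (intro conjI allI impI)
  show "linear (\<lambda>\<omega>. (inertia i1 i3 *v \<omega>) \<bullet> axial_vec \<alpha> \<beta> \<gamma>)" for \<gamma>
    by (intro linearI) (simp_all add: matrix_vector_right_distrib inner_add_left matrix_vector_mult_scaleR)
  show "\<not> (\<exists>c. \<forall>(v, \<omega>, \<gamma>) \<in> phase_set R a. (inertia i1 i3 *v \<omega>) \<bullet> axial_vec \<alpha> \<beta> \<gamma> = c)"
    using assms(1-3) by (rule axial_momentum_not_constant)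
next
  fix T v \<omega> \<gamma>
  assume sol: "solution m R g i1 i3 a Force Mf T v \<omega> \<gamma>"
  then have "convex T"
    by (simp add: solution_def is_interval_convex)
  moreover have "((\<lambda>s. (inertia i1 i3 *v \<omega> s) \<bullet> axial_vec \<alpha> \<beta> (\<gamma> s)) has_derivative (\<lambda>h. 0)) (at t within T)"
    if "t \<in> T" for t
  proof -
    have "(v t, \<omega> t, \<gamma> t) \<in> phase_set R a"
      using sol that by (simp add: solution_def Let_def)
    then show ?thesis
      using axial_momentum_derivative [OF sol that, of \<alpha> \<beta>]
      by (simp add: Mf has_vector_derivative_def)
  qed
  ultimately show "\<exists>c. \<forall>t\<in>T. (inertia i1 i3 *v \<omega> t) \<bullet> axial_vec \<alpha> \<beta> (\<gamma> t) = c"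
    by (rule has_derivative_zero_constant)
qed

theorem mainTheorem1:
  fixes m R g i1 i3 a :: real
    and Force Mf :: "real^3 \<Rightarrow> real^3 \<Rightarrow> real^3 \<Rightarrow> real^3"
  assumes "m > 0" and "R > 0" and "g > 0" and "i1 > 0" and "i3 > 0"
  shows "((\<forall>(v, \<omega>, \<gamma>) \<in> phase_set R a. Mf v \<omega> \<gamma> \<bullet> contact_vec R a \<gamma> = 0) \<longrightarrow>
            additional_linear_integral m R g i1 i3 a Force Mf (jellett_integral m R i1 i3 a)) \<and>
         ((\<forall>(v, \<omega>, \<gamma>) \<in> phase_set R a. Mf v \<omega> \<gamma> \<bullet> e3 = 0) \<longrightarrow>
            additional_linear_integral m R g i1 i3 a Force Mf (lagrange_integral i3)) \<and>
         ((\<forall>(v, \<omega>, \<gamma>) \<in> phase_set R a. Mf v \<omega> \<gamma> \<bullet> \<gamma> = 0) \<longrightarrow>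
            additional_linear_integral m R g i1 i3 a Force Mf (area_integral m R i1 i3 a))"
proof (intro conjI impI)
  have r: "contact_vec R a \<gamma> = - axial_vec R a \<gamma>" for \<gamma>
    by (simp add: contact_vec_def axial_vec_def)
  assume torque: "\<forall>(v, \<omega>, \<gamma>) \<in> phase_set R a. Mf v \<omega> \<gamma> \<bullet> contact_vec R a \<gamma> = 0"
  have M: "Mf v \<omega> \<gamma> \<bullet> axial_vec R a \<gamma> = 0" if "(v, \<omega>, \<gamma>) \<in> phase_set R a" for v \<omega> \<gamma>
    using bspec [OF torque that] by (simp add: r)
  show "additional_linear_integral m R g i1 i3 a Force Mf (jellett_integral m R i1 i3 a)"
    by (rule axial_momentum_is_integral [where \<alpha> = R and \<beta> = a, OF assms(4,5) _ M])
      (use assms(2) in \<open>simp_all add: jellett_integral_def r inertia_J_mult_inner_axial\<close>)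
next
  have K: "axial_vec 0 1 \<gamma> = e3" for \<gamma>
    by (simp add: axial_vec_def)
  assume torque: "\<forall>(v, \<omega>, \<gamma>) \<in> phase_set R a. Mf v \<omega> \<gamma> \<bullet> e3 = 0"
  have M: "Mf v \<omega> \<gamma> \<bullet> axial_vec 0 1 \<gamma> = 0" if "(v, \<omega>, \<gamma>) \<in> phase_set R a" for v \<omega> \<gamma>
    using bspec [OF torque that] by (simp add: K)
  show "additional_linear_integral m R g i1 i3 a Force Mf (lagrange_integral i3)"
    by (rule axial_momentum_is_integral [where \<alpha> = 0 and \<beta> = 1, OF assms(4,5) _ M])
      (simp_all add: lagrange_integral_def K inner_3 e3_nth inertia_mult_nth)
next
  have K: "axial_vec 1 0 \<gamma> = \<gamma>" for \<gamma>
    by (simp add: axial_vec_def)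
  assume torque: "\<forall>(v, \<omega>, \<gamma>) \<in> phase_set R a. Mf v \<omega> \<gamma> \<bullet> \<gamma> = 0"
  have M: "Mf v \<omega> \<gamma> \<bullet> axial_vec 1 0 \<gamma> = 0" if "(v, \<omega>, \<gamma>) \<in> phase_set R a" for v \<omega> \<gamma>
    using bspec [OF torque that] by (simp add: K)
  show "additional_linear_integral m R g i1 i3 a Force Mf (area_integral m R i1 i3 a)"
    by (rule axial_momentum_is_integral [where \<alpha> = 1 and \<beta> = 0, OF assms(4,5) _ M])
      (use inertia_J_mult_inner_axial [where \<alpha> = 1 and \<beta> = 0] in \<open>simp_all add: area_integral_def K\<close>)
qed

end
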